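(* Let $ABC$ be a (non-degenerate) triangle in the Euclidean plane. Let $\mu_1=\mathrm{cl}(\lambda_1)\setminus\{B,C\}$, $\mu_2=\mathrm{cl}(\lambda_2)\setminus\{A,C\}$, $\mu_3=\mathrm{cl}(\lambda_3)\setminus\{A,B\}$, $\mu_4=\lambda_4$, $\mu_5=\lambda_5$, $\mu_6=\lambda_6$, where $\lambda_1,\dots,\lambda_6$ are the regions defined in the context and $\mathrm{cl}$ denotes topological closure in the plane. For every point $M\in\bigcup_{i=1}^{6}\mu_i$, $$R_A+R_B+R_C\ \ge\ \left(\frac{\sqrt{R_C}}{\sqrt{R_B}}+\frac{\sqrt{R_B}}{\sqrt{R_C}}\right)\ell_a'+\left(\frac{\sqrt{R_C}}{\sqrt{R_A}}+\frac{\sqrt{R_A}}{\sqrt{R_C}}\right)\ell_b'+\left(\frac{\sqrt{R_A}}{\sqrt{R_B}}+\frac{\sqrt{R_B}}{\sqrt{R_A}}\right)\ell_c',$$ where $\ell_a',\ell_b',\ell_c'$ are the signed angle bisectors defined in the context. Moreover, at the vertices: if $M=A$, then $R_B+R_C\ge\left(\frac{\sqrt{R_C}}{\sqrt{R_B}}+\frac{\sqrt{R_B}}{\sqrt{R_C}}\right)\ell_a$; if $M=B$, then $R_A+R_C\ge\left(\frac{\sqrt{R_C}}{\sqrt{R_A}}+\frac{\sqrt{R_A}}{\sqrt{R_C}}\right)\ell_b$; if $M=C$, then $R_A+R_B\ge\left(\frac{\sqrt{R_B}}{\sqrt{R_A}}+\frac{\sqrt{R_A}}{\sqrt{R_B}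}\right)\ell_c$.
   Context: For a point $M$ in the plane of triangle $ABC$, put $R_A=|MA|$, $R_B=|MB|$, $R_C=|MC|$. Unsigned bisectors: $\ell_a=|MA'|$, where $A'$ is the point in which the bisector of $\angle BMC$ meets the segment $BC$; similarly $\ell_b=|MB'|$ with $B'$ the point in which the bisector of $\angle CMA$ meets the segment $CA$, and $\ell_c=|MC'|$ with $C'$ the point in which the bisector of $\angle AMB$ meets the segment $AB$. When $M$ lies on the line $BC$ the convention is: $\ell_a=0$ if $M$ belongs to the closed segment $[BC]$, and $\ell_a=\frac{2R_BR_C}{R_B+R_C}$ if $M$ is on the line $BC$ outside $[BC]$; analogously for $\ell_b$ (line $CA$) and $\ell_c$ (line $AB$). Signed bisectors: $\ell_a'=+\ell_a$ if $M$ and $A$ lie strictly on the same side of line $BC$, $\ell_a'=-\ell_a$ if they lie strictly on opposite sides, and if $M$ lies on line $BC$ then $\ell_a'=\ell_a$, that is, $\ell_a'=0$ if $M$ belongs to the closed segment $[BC]$ and $\ell_a'=\frac{2R_BR_C}{R_B+R_C}$ if $M$ is on the line $BC$ outside $[BC]$. $\ell_b'$ (with respect to vertex $B$ and line $CA$) and $\ell_c'$ (with respect to vertex $C$ and line $AB$) are defined analogously. Regions: $\lambda_i$ is the set of points of the plane whose barycentric coordinates with respect to $(A,B,C)$, normalized to sum $1$, have the following strict signs: $\lambda_1=(-,+,+)$, $\lambda_2=(+,-,+)$, $\lambda_3=(+,+,-)$, $\lambda_4=(+,-,-)$, $\lambda_5=(-,+,-)$, $\lambda_6=(-,-,+)$.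 For example, $\lambda_1$ is the part of the interior of angle $\angle A$ lying strictly beyond line $BC$ from $A$, and $\lambda_4$ is the interior of the angle vertically opposite to $\angle A$. *)

theory Defs
  imports "HOL-Analysis.Analysis"
begin

text \<open>The undirected angle \<open>P M Q\<close> with vertex \<open>M\<close>, in \<open>[0, pi]\<close>; meaningful only for
  \<open>P \<noteq> M\<close> and \<open>Q \<noteq> M\<close>.\<close>

definition vertex_angle :: "'a::euclidean_space \<Rightarrow> 'a \<Rightarrow> 'a \<Rightarrow> real" where
  "vertex_angle P M Q = arccos (((P - M) \<bullet> (Q - M)) / (norm (P - M) * norm (Q - M)))"

text \<open>The internal bisector of the angle \<open>P M Q\<close>, as a ray without its origin \<open>M\<close>. It is a single
  ray when the angle is less than \<open>pi\<close>, the only case in which it is used below.\<close>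

definition angle_bisector :: "'a::euclidean_space \<Rightarrow> 'a \<Rightarrow> 'a \<Rightarrow> 'a set" where
  "angle_bisector P M Q =
     {X. X \<noteq> M \<and> vertex_angle P M X = vertex_angle P M Q / 2
                \<and> vertex_angle X M Q = vertex_angle P M Q / 2}"

definition bisector_foot :: "'a::euclidean_space \<Rightarrow> 'a \<Rightarrow> 'a \<Rightarrow> 'a" where
  "bisector_foot P M Q = (THE X. X \<in> closed_segment P Q \<and> X \<in> angle_bisector P M Q)"

text \<open>On the line \<open>PQ\<close> the foot is not well defined (or is \<open>M\<close> itself), and the length is fixed by
  convention.\<close>

definition bisector_length :: "'a::euclidean_space \<Rightarrow> 'a \<Rightarrow> 'a \<Rightarrow> real" where
  "bisector_length P M Q =
     (if M \<in> closed_segment P Q then 0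
      else if M \<in> affine hull {P, Q} then 2 * dist M P * dist M Q / (dist M P + dist M Q)
      else dist M (bisector_foot P M Q))"

text \<open>The points \<open>X\<close> and \<open>Y\<close> lie strictly on the same side of the line \<open>L\<close> in the plane.\<close>

definition strictly_same_side :: "(real^2) set \<Rightarrow> real^2 \<Rightarrow> real^2 \<Rightarrow> bool" where
  "strictly_same_side L X Y \<longleftrightarrow> closed_segment X Y \<inter> L = {}"

definition strictly_opposite_sides :: "(real^2) set \<Rightarrow> real^2 \<Rightarrow> real^2 \<Rightarrow> bool" where
  "strictly_opposite_sides L X Y \<longleftrightarrow> X \<notin> L \<and> Y \<notin> L \<and> closed_segment X Y \<inter> L \<noteq> {}"

text \<open>The bisector of the angle \<open>P M Q\<close>, signed by the side of the line \<open>PQ\<close> on which \<open>M\<close> lies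
  relative to the third vertex \<open>V\<close>. For \<open>V\<close> off the line \<open>PQ\<close>, the last case is exactly the one where
  \<open>M\<close> is on that line.\<close>

definition signed_bisector :: "real^2 \<Rightarrow> real^2 \<Rightarrow> real^2 \<Rightarrow> real^2 \<Rightarrow> real" where
  "signed_bisector V P M Q =
     (if strictly_same_side (affine hull {P, Q}) M V then bisector_length P M Q
      else if strictly_opposite_sides (affine hull {P, Q}) M V then - bisector_length P M Q
      else bisector_length P M Q)"

text \<open>The points whose normalized barycentric coordinates with respect to \<open>(A, B, C)\<close> have the
  signs \<open>a\<close>, \<open>b\<close>, \<open>c\<close>, each being \<open>1\<close> or \<open>-1\<close>.\<close>

definition bary_region :: "real^2 \<Rightarrow> real^2 \<Rightarrow> real^2 \<Rightarrow> real \<Rightarrow> real \<Rightarrow> real \<Rightarrow> (real^2) set" where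
  "bary_region A B C a b c =
     {u *\<^sub>R A + v *\<^sub>R B + w *\<^sub>R C | u v w. u + v + w = 1 \<and> sgn u = a \<and> sgn v = b \<and> sgn w = c}"

end

theory Submission
  imports Defs
begin

text \<open>
  Write \<open>a\<close>, \<open>b\<close>, \<open>c\<close> for the vectors from \<open>M\<close> to the vertices. The bisector of an angle \<open>\<theta>\<close> between
  sides \<open>p\<close> and \<open>q\<close> has length \<open>2 |p| |q| cos (\<theta>/2) / (|p| + |q|)\<close>, and the degenerate conventions
  \<open>\<theta> = \<pi>\<close> and \<open>\<theta> = 0\<close> fit this formula. The weight in front of it is \<open>(|p| + |q|) / sqrt (|p| |q|)\<close>,
  so each term of the right-hand side is, up to sign, \<open>2 sqrt (|p| |q|) cos (\<theta>/2)\<close>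
  (\<open>weighted_bisector_length\<close>). If the vectors of the plane are read as complex numbers and \<open>p'\<close>, \<open>q'\<close>
  are square roots of \<open>p\<close>, \<open>q\<close>, then this quantity is \<open>2 |p' \<bullet> q'|\<close>, where \<open>|p'|\<^sup>2 = |p|\<close>.

  Beyond the side \<open>BC\<close> the signs are \<open>(-, +, +)\<close> and the claim reads
  \<open>|a'|\<^sup>2 + |b'|\<^sup>2 + |c'|\<^sup>2 + 2 |b' \<bullet> c'| \<ge> 2 |a' \<bullet> c'| + 2 |a' \<bullet> b'|\<close>. Square roots are determined only up
  to sign, so both products with \<open>a'\<close> may be taken nonnegative, and the claim follows from
  \<open>|a' - b' - c'|\<^sup>2 \<ge> 0\<close> (\<open>half_angle_product_inequality\<close>). In the angle vertically opposite to \<open>A\<close> the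
  signs are \<open>(+, -, -)\<close>, and the single positive term is at most \<open>|b| + |c|\<close> by the inequality
  of the arithmetic and geometric means; this also settles the vertices. Only the signs
  enter, and these are the signs of the barycentric coordinates, which are ratios of
  oriented areas. On the boundary of a region a vanishing coordinate turns the sign
  into \<open>+\<close>; this matters only for the coordinate that should be negative, and there \<open>M\<close> lies on the
  closed side and the bisector has length \<open>0\<close>.
\<close>

section \<open>The weighted length of a bisector\<close>

text \<open>If \<open>\<theta>\<close> is the angle between \<open>p\<close> and \<open>q\<close>, this is \<open>2 sqrt (|p| |q|) cos (\<theta>/2)\<close>; the form chosen
  needs no angles.\<close>

definition half_angle_product :: "'a::real_inner \<Rightarrow> 'a \<Rightarrow> real" where
  "half_angle_product p q = sqrt (2 * (norm p * norm q + p \<bullet> q))"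

lemma half_angle_product_commute: "half_angle_product p q = half_angle_product q p"
  by (simp add: half_angle_product_def inner_commute mult.commute)

lemma norm_mult_plus_inner_nonneg: "0 \<le> norm p * norm q + p \<bullet> (q :: 'a::real_inner)"
  using Cauchy_Schwarz_ineq2[of p q] by linarith

lemma half_angle_product_nonneg: "0 \<le> half_angle_product p q"
  using norm_mult_plus_inner_nonneg[of p q] by (simp add: half_angle_product_def)

lemma half_angle_product_le: "half_angle_product p q \<le> norm p + norm q"
  unfolding half_angle_product_def
proof (rule real_le_lsqrt)
  have "0 \<le> (norm p - norm q)\<^sup>2" by simp
  then show "2 * (norm p * norm q + p \<bullet> q) \<le> (norm p + norm q)\<^sup>2"
    using norm_cauchy_schwarz[of p q] by (simp add: power2_eq_square algebra_simps)
qed simp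

lemma norm_bisecting_vector:
  fixes p q :: "'a::real_inner"
  shows "norm (norm q *\<^sub>R p + norm p *\<^sub>R q) = sqrt (norm p * norm q) * half_angle_product p q"
proof -
  have "(norm q *\<^sub>R p + norm p *\<^sub>R q) \<bullet> (norm q *\<^sub>R p + norm p *\<^sub>R q)
      = norm q * norm q * (p \<bullet> p) + norm p * norm p * (q \<bullet> q) + 2 * (norm p * norm q * (p \<bullet> q))"
    by (simp add: inner_add_left inner_add_right inner_commute algebra_simps)
  also have "\<dots> = norm p * norm q * (2 * (norm p * norm q + p \<bullet> q))"
    unfolding dot_square_norm by (simp add: power2_eq_square algebra_simps)
  finally show ?thesis
    by (simp add: norm_eq_sqrt_inner[of "norm q *\<^sub>R p + norm p *\<^sub>R q"] half_angle_product_def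
        real_sqrt_mult)
qed

text \<open>The vector \<open>|q| p + |p| q\<close> is the diagonal of a rhombus, hence halves the angle.
  By the half-angle formula, \<open>cos (\<theta>/2)\<close> is \<open>half_angle_product p q / (2 sqrt (|p| |q|))\<close>.\<close>

lemma vertex_angle_bisecting_vector:
  fixes p q M :: "'a::euclidean_space"
  assumes p: "p \<noteq> 0" and q: "q \<noteq> 0" and pos: "0 < norm p * norm q + p \<bullet> q" and k: "k > 0"
  shows "vertex_angle (M + p) M (M + k *\<^sub>R (norm q *\<^sub>R p + norm p *\<^sub>R q))
       = vertex_angle (M + p) M (M + q) / 2"
proof -
  let ?z = "norm q *\<^sub>R p + norm p *\<^sub>R q"
  define s where "s = norm p * norm q"
  define c where "c = p \<bullet> q / s"
  have s: "s > 0" using p q by (simp add: s_def)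
  have pq: "p \<bullet> q = s * c" using s by (simp add: c_def)
  have "\<bar>p \<bullet> q\<bar> \<le> s" unfolding s_def by (rule Cauchy_Schwarz_ineq2)
  then have c: "-1 \<le> c" "c \<le> 1" using s by (auto simp: c_def field_simps abs_le_iff)
  have c': "c > -1" using pos s by (simp add: c_def s_def field_simps)
  have h: "half_angle_product p q = sqrt s * sqrt (2 * (1 + c))"
  proof -
    have "2 * (norm p * norm q + p \<bullet> q) = s * (2 * (1 + c))"
      unfolding pq by (simp add: s_def algebra_simps)
    then show ?thesis by (simp add: half_angle_product_def real_sqrt_mult)
  qed
  have nz: "norm ?z = s * sqrt (2 * (1 + c))"
    using s unfolding norm_bisecting_vector h by (simp flip: s_def mult.assoc)
  have "p \<bullet> ?z = norm q * (p \<bullet> p) + norm p * (p \<bullet> q)"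
    by (simp add: inner_add_right)
  also have "\<dots> = norm p * (s * (1 + c))"
    unfolding dot_square_norm pq by (simp add: s_def power2_eq_square algebra_simps)
  finally have pz: "p \<bullet> ?z = norm p * (s * (1 + c))" .
  have "p \<bullet> (k *\<^sub>R ?z) / (norm p * norm (k *\<^sub>R ?z)) = (p \<bullet> ?z) / (norm p * norm ?z)"
    using k by simp
  also have "\<dots> = (1 + c) / sqrt (2 * (1 + c))"
    unfolding pz nz using p s by simp
  also have "\<dots> = sqrt ((1 + c) / 2)"
  proof -
    have "e / sqrt (2 * e) = sqrt (e / 2)" if "e > 0" for e :: real
      using that by (simp add: real_sqrt_mult real_sqrt_divide divide_simps)
    from this[of "1 + c"] show ?thesis using c' by simp
  qed
  also have "\<dots> = cos (arccos c / 2)"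
  proof (rule real_sqrt_unique)
    show "(cos (arccos c / 2))\<^sup>2 = (1 + c) / 2"
      using cos_double_cos[of "arccos c / 2"] c by simp
    show "0 \<le> cos (arccos c / 2)"
      using c arccos_lbound[of c] arccos_ubound[of c] by (intro cos_ge_zero) auto
  qed
  finally have "arccos (p \<bullet> (k *\<^sub>R ?z) / (norm p * norm (k *\<^sub>R ?z))) = arccos c / 2"
    using c arccos_lbound[of c] arccos_ubound[of c] by (simp add: arccos_cos)
  then show ?thesis by (simp add: vertex_angle_def c_def s_def)
qed

lemma vertex_angle_commute: "vertex_angle P M Q = vertex_angle Q M P"
  by (simp add: vertex_angle_def inner_commute mult.commute)

lemma strict_Cauchy_Schwarz_off_line:
  fixes P Q M :: "'a::euclidean_space"
  assumes "P \<noteq> Q" and "M \<notin> affine hull {P, Q}"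
  shows "\<bar>(P - M) \<bullet> (Q - M)\<bar> < norm (P - M) * norm (Q - M)"
proof -
  have "\<bar>(P - M) \<bullet> (Q - M)\<bar> \<noteq> norm (P - M) * norm (Q - M)"
  proof
    assume "\<bar>(P - M) \<bullet> (Q - M)\<bar> = norm (P - M) * norm (Q - M)"
    then have "collinear {0, P - M, Q - M}" by (simp add: norm_cauchy_schwarz_equal)
    then have "collinear {P, M, Q}" by (simp add: collinear_3)
    then have "collinear {P, Q, M}" by (simp add: insert_commute)
    then show False using assms by (simp add: collinear_3_affine_hull)
  qed
  then show ?thesis using Cauchy_Schwarz_ineq2[of "P - M" "Q - M"] by linarith
qed

text \<open>Among the points \<open>M + s p + t q\<close> only those on one line through \<open>M\<close> see \<open>p\<close> and \<open>q\<close> under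
  equal angles: equality of the cosines is the linear equation \<open>(s |p| - t |q|) (|p| |q| - p \<bullet> q) = 0\<close>.
  The segment meets this line in the point dividing it in the ratio \<open>|p| : |q|\<close>.\<close>

lemma bisector_foot_eq:
  fixes P Q M :: "'a::euclidean_space"
  assumes PQ: "P \<noteq> Q" and off: "M \<notin> affine hull {P, Q}"
  defines "p \<equiv> P - M" and "q \<equiv> Q - M"
  shows "bisector_foot P M Q = M + (1 / (norm p + norm q)) *\<^sub>R (norm q *\<^sub>R p + norm p *\<^sub>R q)"
proof -
  define k where "k = 1 / (norm p + norm q)"
  define z where "z = norm q *\<^sub>R p + norm p *\<^sub>R q"
  have "P \<in> affine hull {P, Q}" "Q \<in> affine hull {P, Q}" by (auto intro: hull_inc)
  with off have p: "p \<noteq> 0" and q: "q \<noteq> 0" by (auto simp: p_def q_def)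
  have CS: "\<bar>p \<bullet> q\<bar> < norm p * norm q"
    using strict_Cauchy_Schwarz_off_line[OF PQ off] by (simp add: p_def q_def)
  have k: "k > 0" using p q by (simp add: k_def add_pos_pos)
  have k1: "k * norm q + k * norm p = 1" using p q
    by (simp add: k_def add_nonneg_eq_0_iff field_simps)
  have seg: "M + k *\<^sub>R z \<in> closed_segment P Q"
  proof -
    have "M + k *\<^sub>R z = (k * norm q + k * norm p) *\<^sub>R M + (k * norm q) *\<^sub>R p + (k * norm p) *\<^sub>R q"
      unfolding k1 by (simp add: z_def scaleR_add_right)
    also have "\<dots> = (k * norm q) *\<^sub>R P + (k * norm p) *\<^sub>R Q"
      by (simp add: p_def q_def algebra_simps)
    also have "k * norm q = 1 - k * norm p" using k1 by simp
    finally have "M + k *\<^sub>R z = (1 - k * norm p) *\<^sub>R P + (k * norm p) *\<^sub>R Q" .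
    moreover have "0 \<le> k * norm p" using k by simp
    moreover have "k * norm p \<le> 1" using k1 mult_nonneg_nonneg[OF less_imp_le[OF k] norm_ge_zero, of q] by linarith
    ultimately show ?thesis unfolding closed_segment_def by blast
  qed
  have "vertex_angle P M (M + k *\<^sub>R z) = vertex_angle P M Q / 2"
    using vertex_angle_bisecting_vector[OF p q _ k, of M] CS by (simp add: z_def p_def q_def)
  moreover have "vertex_angle Q M (M + k *\<^sub>R z) = vertex_angle Q M P / 2"
    using vertex_angle_bisecting_vector[OF q p _ k, of M] CS
    by (simp add: z_def p_def q_def inner_commute mult.commute add.commute)
  moreover have "norm z \<noteq> 0"
    unfolding z_def norm_bisecting_vector using p q CS by (simp add: half_angle_product_def)
  ultimately have bis: "M + k *\<^sub>R z \<in> angle_bisector P M Q"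
    using k by (simp add: angle_bisector_def vertex_angle_commute)
  show ?thesis
    unfolding bisector_foot_def k_def[symmetric] z_def[symmetric]
  proof (rule the_equality)
    fix X assume X: "X \<in> closed_segment P Q \<and> X \<in> angle_bisector P M Q"
    then obtain t where t: "X = (1 - t) *\<^sub>R P + t *\<^sub>R Q" by (auto simp: closed_segment_def)
    define x where "x = X - M"
    have x: "x = (1 - t) *\<^sub>R p + t *\<^sub>R q" by (simp add: x_def t p_def q_def algebra_simps)
    from X have "x \<noteq> 0" "vertex_angle P M X = vertex_angle Q M X"
      by (auto simp: angle_bisector_def vertex_angle_commute x_def)
    then have "arccos (p \<bullet> x / (norm p * norm x)) = arccos (q \<bullet> x / (norm q * norm x))"
      by (simp add: vertex_angle_def p_def q_def x_def)
    moreover have "\<bar>y \<bullet> x / (norm y * norm x)\<bar> \<le> 1" if "y \<noteq> 0" for y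
      using that \<open>x \<noteq> 0\<close> Cauchy_Schwarz_ineq2[of y x] by (simp add: abs_mult)
    ultimately have "p \<bullet> x / (norm p * norm x) = q \<bullet> x / (norm q * norm x)"
      using p q arccos_eq_iff by blast
    then have "norm q * (p \<bullet> x) = norm p * (q \<bullet> x)"
      using p q \<open>x \<noteq> 0\<close> by (simp add: field_simps)
    then have "norm q * ((1 - t) * (p \<bullet> p) + t * (p \<bullet> q)) = norm p * ((1 - t) * (p \<bullet> q) + t * (q \<bullet> q))"
      by (simp add: x inner_add_right inner_commute)
    then have "((1 - t) * norm p - t * norm q) * (norm p * norm q - p \<bullet> q) = 0"
      unfolding dot_square_norm by (simp add: power2_eq_square algebra_simps)
    moreover have "norm p * norm q - p \<bullet> q \<noteq> 0" using CS by linarith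
    ultimately have "(1 - t) * norm p - t * norm q = 0" by (simp only: mult_eq_0_iff) simp
    then have "t * (norm p + norm q) = norm p" by (simp add: algebra_simps)
    then have "t = k * norm p" using k1 p q by (simp add: k_def field_simps add_nonneg_eq_0_iff)
    moreover from this have "1 - t = k * norm q" using k1 by simp
    ultimately have "x = k *\<^sub>R z" by (simp add: x z_def scaleR_add_right)
    then show "X = M + k *\<^sub>R z" by (simp add: x_def algebra_simps)
  qed (use seg bis in blast)
qed

text \<open>The stipulated lengths \<open>0\<close> and \<open>2 |p| |q| / (|p| + |q|)\<close> for \<open>M\<close> on the line \<open>PQ\<close> are the values of
  the general formula at the angles \<open>\<pi>\<close> and \<open>0\<close>, where \<open>p \<bullet> q\<close> is \<open>- |p| |q|\<close> and \<open>|p| |q|\<close>.\<close>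

lemma bisector_length_eq:
  fixes P Q M :: "'a::euclidean_space"
  assumes PQ: "P \<noteq> Q"
  defines "p \<equiv> P - M" and "q \<equiv> Q - M"
  shows "bisector_length P M Q
       = sqrt (norm p * norm q) * half_angle_product p q / (norm p + norm q)"
proof (cases "M \<in> affine hull {P, Q}")
  case False
  then have "M \<notin> closed_segment P Q"
    using convex_hull_subset_affine_hull[of "{P, Q}"] by (auto simp: segment_convex_hull)
  with False show ?thesis
    unfolding p_def q_def
    by (simp add: bisector_length_def bisector_foot_eq[OF PQ] dist_norm norm_bisecting_vector)
next
  case True
  then obtain u v where uv: "u + v = 1" and M: "M = u *\<^sub>R P + v *\<^sub>R Q"
    by (auto simp: affine_hull_2)
  have u: "u = 1 - v" using uv by simp
  have p: "p = v *\<^sub>R (P - Q)" and q: "q = (- u) *\<^sub>R (P - Q)"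
    by (simp_all add: p_def q_def M u algebra_simps)
  have inner: "p \<bullet> q = - (u * v) * (norm (P - Q))\<^sup>2"
    unfolding p q by (simp add: power2_norm_eq_inner)
  have norms: "norm p * norm q = \<bar>u * v\<bar> * (norm (P - Q))\<^sup>2"
    unfolding p q by (simp add: abs_mult power2_eq_square)
  have dist: "dist M P = norm p" "dist M Q = norm q"
    by (simp_all add: p_def q_def dist_norm norm_minus_commute)
  show ?thesis
  proof (cases "M \<in> closed_segment P Q")
    case seg: True
    then obtain t where t: "0 \<le> t" "t \<le> 1" "M = (1 - t) *\<^sub>R P + t *\<^sub>R Q"
      by (auto simp: closed_segment_def)
    have "(v - t) *\<^sub>R (P - Q) = 0" using t(3) M by (simp add: u algebra_simps)
    then have "v = t" using PQ by simp
    then have "0 \<le> u * v" using t u by simp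
    then have "norm p * norm q + p \<bullet> q = 0" unfolding inner norms by simp
    then show ?thesis using seg by (simp add: bisector_length_def half_angle_product_def)
  next
    case nseg: False
    have "u * v < 0"
    proof (rule ccontr)
      assume "\<not> u * v < 0"
      then have "0 \<le> v \<and> v \<le> 1" using uv by (auto simp: not_less zero_le_mult_iff)
      then show False using nseg M u by (auto simp: closed_segment_def)
    qed
    then have "2 * (norm p * norm q + p \<bullet> q) = 2\<^sup>2 * (norm p * norm q)"
      unfolding inner norms by simp
    then have "sqrt (norm p * norm q) * half_angle_product p q = 2 * (norm p * norm q)"
      unfolding half_angle_product_def by (simp only: real_sqrt_mult[of "2\<^sup>2"]) simp
    then show ?thesis using True nseg dist by (simp add: bisector_length_def)
  qed
qed

lemma weighted_bisector_length:
  fixes P Q M :: "'a::euclidean_space"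
  assumes "P \<noteq> Q" "M \<noteq> P" "M \<noteq> Q"
  shows "(sqrt (dist M Q) / sqrt (dist M P) + sqrt (dist M P) / sqrt (dist M Q)) * bisector_length P M Q
       = half_angle_product (P - M) (Q - M)"
proof -
  define x y where "x = norm (P - M)" and "y = norm (Q - M)"
  have pos: "x > 0" "y > 0" using assms by (auto simp: x_def y_def)
  have "sqrt y / sqrt x + sqrt x / sqrt y = (x + y) / sqrt (x * y)"
    using pos by (simp add: real_sqrt_mult field_simps flip: power2_eq_square)
  then show ?thesis
    using pos unfolding bisector_length_eq[OF assms(1)]
    by (simp add: dist_norm norm_minus_commute[of M] add_pos_pos add_nonneg_eq_0_iff
        flip: x_def y_def)
qed

section \<open>The inequality between half-angle products\<close>

text \<open>Complex square roots halve angles: \<open>Re (w cnj z)\<close> for the roots of two vectors is, up to sign,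
  half of their half-angle product.\<close>

lemma half_angle_product_csqrt:
  fixes a b :: complex
  shows "half_angle_product a b = 2 * \<bar>csqrt a \<bullet> csqrt b\<bar>"
proof -
  define w z where "w = csqrt a" and "z = csqrt b"
  have "norm (w\<^sup>2) * norm (z\<^sup>2) + w\<^sup>2 \<bullet> z\<^sup>2 = 2 * (w \<bullet> z)\<^sup>2"
    unfolding norm_power cmod_power2
    by (simp add: inner_complex_def power2_eq_square algebra_simps)
  then have "2 * (norm (w\<^sup>2) * norm (z\<^sup>2) + w\<^sup>2 \<bullet> z\<^sup>2) = (2 * (w \<bullet> z))\<^sup>2"
    by (simp add: power_mult_distrib)
  then have "half_angle_product (w\<^sup>2) (z\<^sup>2) = 2 * \<bar>w \<bullet> z\<bar>"
    unfolding half_angle_product_def by (simp only: real_sqrt_abs abs_mult abs_numeral)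
  then show ?thesis by (simp add: w_def z_def)
qed

text \<open>Replacing the square roots \<open>y\<close>, \<open>z\<close> of \<open>b\<close>, \<open>c\<close> by their negatives where necessary makes
  their inner products with the square root \<open>x\<close> of \<open>a\<close> nonnegative; the inequality is then
  \<open>|x - y - z|\<^sup>2 \<ge> 0\<close>, with \<open>y \<bullet> z\<close> estimated by its absolute value.\<close>

lemma half_angle_product_inequality_complex:
  fixes a b c :: complex
  shows "half_angle_product c a + half_angle_product a b
       \<le> norm a + norm b + norm c + half_angle_product b c"
proof -
  define x where "x = csqrt a"
  define y where "y = (if x \<bullet> csqrt b \<ge> 0 then csqrt b else - csqrt b)"
  define z where "z = (if x \<bullet> csqrt c \<ge> 0 then csqrt c else - csqrt c)"
  have norms: "norm a = x \<bullet> x" "norm b = y \<bullet> y" "norm c = z \<bullet> z"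
    by (simp_all add: x_def y_def z_def dot_square_norm flip: norm_power)
  have prods: "half_angle_product a b = 2 * (x \<bullet> y)" "half_angle_product c a = 2 * (x \<bullet> z)"
    "half_angle_product b c = 2 * \<bar>y \<bullet> z\<bar>"
    unfolding half_angle_product_csqrt by (auto simp: x_def y_def z_def inner_commute)
  have "0 \<le> (x - y - z) \<bullet> (x - y - z)" by simp
  then have "2 * (x \<bullet> y) + 2 * (x \<bullet> z) \<le> x \<bullet> x + y \<bullet> y + z \<bullet> z + 2 * (y \<bullet> z)"
    by (simp add: inner_diff_left inner_diff_right inner_commute)
  then show ?thesis unfolding norms prods by linarith
qed

lemma half_angle_product_inequality:
  fixes a b c :: "real^2"
  shows "half_angle_product c a + half_angle_product a b
       \<le> norm a + norm b + norm c + half_angle_product b c"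
proof -
  define f :: "real^2 \<Rightarrow> complex" where "f v = Complex (v $ 1) (v $ 2)" for v
  have inner: "f v \<bullet> f w = v \<bullet> w" for v w
    by (simp add: f_def inner_complex_def inner_vec_def sum_2)
  have norm: "norm (f v) = norm v" for v
    by (simp add: norm_eq_sqrt_inner inner)
  have "half_angle_product (f v) (f w) = half_angle_product v w" for v w
    by (simp add: half_angle_product_def inner norm)
  then show ?thesis
    using half_angle_product_inequality_complex[of "f c" "f a" "f b"] by (simp add: norm)
qed

section \<open>Oriented areas and signs\<close>

text \<open>Twice the oriented area of the triangle \<open>P Q X\<close>.\<close>

definition orient :: "real^2 \<Rightarrow> real^2 \<Rightarrow> real^2 \<Rightarrow> real" where
  "orient P Q X = (P $ 1 - X $ 1) * (Q $ 2 - X $ 2) - (P $ 2 - X $ 2) * (Q $ 1 - X $ 1)"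

lemma orient_cyclic: "orient Q R P = orient P Q R"
  by (simp add: orient_def algebra_simps)

lemma orient_convex: "orient P Q ((1 - t) *\<^sub>R X + t *\<^sub>R Y) = (1 - t) * orient P Q X + t * orient P Q Y"
  by (simp add: orient_def algebra_simps)

lemma orient_barycentric:
  assumes "u + v + w = 1"
  shows "orient B C (u *\<^sub>R A + v *\<^sub>R B + w *\<^sub>R C) = u * orient A B C"
proof -
  have u: "u = 1 - v - w" using assms by simp
  show ?thesis unfolding u by (simp add: orient_def algebra_simps)
qed

lemma collinear_if_orient_eq_0:
  assumes "orient A B C = 0"
  shows "collinear {A, B, C}"
proof -
  define x y where "x = A - B" and "y = C - B"
  have eq: "x $ 1 * y $ 2 = x $ 2 * y $ 1"
    using assms by (simp add: x_def y_def orient_def algebra_simps)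
  have "collinear {0, x, y}"
  proof (cases "x = 0")
    case False
    then consider "x $ 1 \<noteq> 0" | "x $ 2 \<noteq> 0" by (auto simp: vec_eq_iff forall_2)
    then have "\<exists>c. y = c *\<^sub>R x"
    proof cases
      case 1
      then have "y = (y $ 1 / x $ 1) *\<^sub>R x" using eq by (simp add: vec_eq_iff forall_2 field_simps)
      then show ?thesis by blast
    next
      case 2
      then have "y = (y $ 2 / x $ 2) *\<^sub>R x" using eq by (simp add: vec_eq_iff forall_2 field_simps)
      then show ?thesis by blast
    qed
    then show ?thesis by (simp add: collinear_lemma)
  qed (simp add: collinear_lemma)
  then show ?thesis by (simp add: collinear_3 x_def y_def)
qed

text \<open>The vertices weighted by the oriented areas opposite to them average to \<open>M\<close>; the weights add
  up to the area of the whole triangle.\<close>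

lemma barycentric_orient:
  assumes "orient A B C \<noteq> 0"
  defines "D \<equiv> orient A B C"
  shows "(orient B C M / D) *\<^sub>R A + (orient C A M / D) *\<^sub>R B + (orient A B M / D) *\<^sub>R C = M"
    and "orient B C M / D + orient C A M / D + orient A B M / D = 1"
proof -
  have D: "D \<noteq> 0" using assms by simp
  have sum: "orient B C M + orient C A M + orient A B M = D"
    by (simp add: D_def orient_def algebra_simps)
  then show "orient B C M / D + orient C A M / D + orient A B M / D = 1"
    using D by (simp flip: add_divide_distrib)
  have "orient B C M * A $ i + orient C A M * B $ i + orient A B M * C $ i = D * M $ i" for i
    using exhaust_2[of i] by (auto simp: D_def orient_def algebra_simps)
  then show "(orient B C M / D) *\<^sub>R A + (orient C A M / D) *\<^sub>R B + (orient A B M / D) *\<^sub>R C = M"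
    using D by (simp add: vec_eq_iff divide_simps)
qed

lemma orient_eq_0_iff:
  assumes "orient P Q V \<noteq> 0"
  shows "orient P Q X = 0 \<longleftrightarrow> X \<in> affine hull {P, Q}"
proof
  assume "orient P Q X = 0"
  then have "X = (orient Q V X / orient P Q V) *\<^sub>R P + (orient V P X / orient P Q V) *\<^sub>R Q"
    "orient Q V X / orient P Q V + orient V P X / orient P Q V = 1"
    using barycentric_orient[OF assms, of X] by simp_all
  then show "X \<in> affine hull {P, Q}" unfolding affine_hull_2 by blast
next
  assume "X \<in> affine hull {P, Q}"
  then obtain u v where "X = u *\<^sub>R P + v *\<^sub>R Q" "u + v = 1" by (auto simp: affine_hull_2)
  then show "orient P Q X = 0" using orient_barycentric[of 0 u v P Q V] by simp
qed

text \<open>The oriented area is affine in its last argument, so along the segment from \<open>M\<close> to \<open>V\<close> it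
  vanishes somewhere if its signs at the ends differ, and nowhere if they are equal.\<close>

lemma signed_bisector_eq:
  assumes V: "orient P Q V \<noteq> 0"
  shows "signed_bisector V P M Q
       = (if orient P Q M / orient P Q V < 0 then - bisector_length P M Q else bisector_length P M Q)"
proof (cases "orient P Q M / orient P Q V < 0")
  case True
  define t where "t = orient P Q M / (orient P Q M - orient P Q V)"
  have t: "0 \<le> t" "t \<le> 1" and d: "orient P Q M - orient P Q V \<noteq> 0"
    using True by (auto simp: t_def divide_simps split: if_splits)
  have "(1 - t) * orient P Q M + t * orient P Q V = 0"
    using d by (simp add: t_def field_simps)
  then have "(1 - t) *\<^sub>R M + t *\<^sub>R V \<in> affine hull {P, Q}"
    by (simp add: orient_convex flip: orient_eq_0_iff[OF V])
  moreover have "(1 - t) *\<^sub>R M + t *\<^sub>R V \<in> closed_segment M V"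
    using t by (auto simp: closed_segment_def)
  moreover have "M \<notin> affine hull {P, Q}" "V \<notin> affine hull {P, Q}"
    using True V by (auto simp flip: orient_eq_0_iff[OF V])
  ultimately show ?thesis
    using True by (auto simp: signed_bisector_def strictly_same_side_def strictly_opposite_sides_def)
next
  case False
  have "\<not> strictly_opposite_sides (affine hull {P, Q}) M V"
  proof
    assume opp: "strictly_opposite_sides (affine hull {P, Q}) M V"
    then obtain t where t: "0 \<le> t" "t \<le> 1" and "(1 - t) *\<^sub>R M + t *\<^sub>R V \<in> affine hull {P, Q}"
      by (auto simp: strictly_opposite_sides_def closed_segment_def)
    then have "(1 - t) * orient P Q M + t * orient P Q V = 0"
      by (simp add: orient_convex flip: orient_eq_0_iff[OF V])
    then have "(1 - t) * (orient P Q M / orient P Q V) + t = 0"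
      using V by (simp add: field_simps)
    moreover have "orient P Q M / orient P Q V > 0"
      using opp False by (auto simp: strictly_opposite_sides_def less_le simp flip: orient_eq_0_iff[OF V])
    ultimately show False using t
      by (smt (verit) mult_nonneg_nonneg mult_eq_0_iff)
  qed
  then show ?thesis using False by (simp add: signed_bisector_def)
qed

section \<open>The regions\<close>

lemma orient_nonzero:
  assumes "\<not> collinear {A, B, C}"
  shows "orient A B C \<noteq> 0" "orient B C A \<noteq> 0" "orient C A B \<noteq> 0"
  using collinear_if_orient_eq_0[of A B C] assms orient_cyclic[of A B C] orient_cyclic[of B C A] by auto

lemma bary_region_signs:
  assumes D: "orient A B C \<noteq> 0" and M: "M \<in> bary_region A B C a b c"
  shows "sgn (orient B C M / orient A B C) = a" "sgn (orient C A M / orient A B C) = b"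
    "sgn (orient A B M / orient A B C) = c"
proof -
  from M obtain u v w where uvw: "u + v + w = 1" "sgn u = a" "sgn v = b" "sgn w = c"
    and M: "M = u *\<^sub>R A + v *\<^sub>R B + w *\<^sub>R C"
    by (auto simp: bary_region_def)
  have "orient B C M = u * orient A B C"
    using orient_barycentric[of u v w B C A] uvw by (simp add: M)
  moreover have "orient C A M = v * orient A B C"
    using orient_barycentric[of v w u C A B] uvw orient_cyclic[of A B C] orient_cyclic[of C A B]
    by (simp add: M add_ac)
  moreover have "orient A B M = w * orient A B C"
    using orient_barycentric[of w u v A B C] uvw orient_cyclic[of A B C] orient_cyclic[of C A B]
    by (simp add: M add_ac)
  ultimately show "sgn (orient B C M / orient A B C) = a" "sgn (orient C A M / orient A B C) = b"
    "sgn (orient A B M / orient A B C) = c"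
    using D uvw by simp_all
qed

lemma bary_region_cyclic: "bary_region A B C a b c = bary_region B C A b c a"
proof -
  have "bary_region A B C a b c \<subseteq> bary_region B C A b c a" for A B C a b c
  proof
    fix X assume "X \<in> bary_region A B C a b c"
    then obtain u v w where uvw: "u + v + w = 1" "sgn u = a" "sgn v = b" "sgn w = c"
      and X: "X = u *\<^sub>R A + v *\<^sub>R B + w *\<^sub>R C"
      by (auto simp: bary_region_def)
    have "X = v *\<^sub>R B + w *\<^sub>R C + u *\<^sub>R A" "v + w + u = 1" using X uvw by (simp_all add: add_ac)
    with uvw show "X \<in> bary_region B C A b c a" unfolding bary_region_def by blast
  qed
  then show ?thesis by blast
qed

text \<open>The barycentric coordinates are continuous, so the strict inequalities that define a
  region become weak ones on its closure.\<close>

lemma closure_bary_region_signs: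
  assumes D: "orient A B C \<noteq> 0" and M: "M \<in> closure (bary_region A B C (-1) 1 1)"
  shows "orient B C M / orient A B C \<le> 0" "orient C A M / orient A B C \<ge> 0"
    "orient A B M / orient A B C \<ge> 0"
proof -
  let ?D = "orient A B C"
  let ?S = "{X. orient B C X / ?D \<le> 0} \<inter> {X. 0 \<le> orient C A X / ?D} \<inter> {X. 0 \<le> orient A B X / ?D}"
  have "continuous_on UNIV (\<lambda>X. orient P Q X / ?D)" for P Q
    unfolding divide_inverse orient_def by (intro continuous_intros)
  then have "closed ?S"
    by (intro closed_Int closed_Collect_le continuous_on_const)
  moreover have "bary_region A B C (-1) 1 1 \<subseteq> ?S"
  proof
    fix X assume "X \<in> bary_region A B C (-1) 1 1"
    from bary_region_signs[OF D this] show "X \<in> ?S" unfolding sgn_1_pos sgn_1_neg by simp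
  qed
  ultimately have "M \<in> ?S" using M closure_minimal by blast
  then show "orient B C M / ?D \<le> 0" "orient C A M / ?D \<ge> 0" "orient A B M / ?D \<ge> 0" by auto
qed

definition bisector_term :: "real^2 \<Rightarrow> real^2 \<Rightarrow> real^2 \<Rightarrow> real^2 \<Rightarrow> real" where
  "bisector_term V P M Q
     = (sqrt (dist M Q) / sqrt (dist M P) + sqrt (dist M P) / sqrt (dist M Q)) * signed_bisector V P M Q"

lemma bisector_term_eq:
  assumes "orient P Q V \<noteq> 0" "M \<noteq> P" "M \<noteq> Q"
  shows "bisector_term V P M Q
       = (if orient P Q M / orient P Q V < 0 then - half_angle_product (P - M) (Q - M)
          else half_angle_product (P - M) (Q - M))"
proof -
  have "P \<noteq> Q" using assms(1) by (auto simp: orient_def)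
  from weighted_bisector_length[OF this assms(2,3)] show ?thesis
    unfolding bisector_term_def signed_bisector_eq[OF assms(1)] by simp
qed

text \<open>Here the term of the side \<open>BC\<close> enters with the sign \<open>-\<close>, the other two with \<open>+\<close>. A point of the line
  \<open>BC\<close> would get \<open>+\<close> instead, but as its other two coordinates are nonnegative it lies between \<open>B\<close>
  and \<open>C\<close>, where the term vanishes. On the other two lines the sign \<open>+\<close> is the one wanted.\<close>

lemma inequality_beyond_side:
  assumes nc: "\<not> collinear {A, B, C}" and M: "M \<in> closure (bary_region A B C (-1) 1 1)"
    and B: "M \<noteq> B" and C: "M \<noteq> C"
  shows "bisector_term A B M C + bisector_term B C M A + bisector_term C A M B
       \<le> dist M A + dist M B + dist M C"
proof -
  note D = orient_nonzero[OF nc]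
  have cyc: "orient B C A = orient A B C" "orient C A B = orient A B C"
    by (simp_all add: orient_cyclic[of A B C] orient_cyclic[of C A B])
  note signs = closure_bary_region_signs[OF D(1) M]
  have "M \<noteq> A" using signs(1) D(1) by (auto simp: cyc)
  note eq = bisector_term_eq[OF D(2) B C] bisector_term_eq[OF D(3) C this]
    bisector_term_eq[OF D(1) this B]
  have "half_angle_product (B - M) (C - M) = 0" if "\<not> orient B C M / orient A B C < 0"
  proof -
    from that signs(1) have "orient B C M / orient A B C = 0" by linarith
    with barycentric_orient[OF D(1), of M] signs(2,3) have "M \<in> closed_segment B C"
      by (simp add: segment_convex_hull convex_hull_2) metis
    moreover have "B \<noteq> C" using nc by auto
    ultimately show ?thesis
      using weighted_bisector_length[of B C M] B C by (simp add: bisector_length_def)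
  qed
  then have "bisector_term A B M C = - half_angle_product (B - M) (C - M)"
    unfolding eq cyc by simp
  moreover have "bisector_term B C M A = half_angle_product (C - M) (A - M)"
    "bisector_term C A M B = half_angle_product (A - M) (B - M)"
    using signs unfolding eq cyc by auto
  ultimately show ?thesis
    using half_angle_product_inequality[of "C - M" "A - M" "B - M"]
    by (simp add: dist_norm norm_minus_commute[of M])
qed

text \<open>Only the term of \<open>BC\<close> is positive, and \<open>R\<^sub>B + R\<^sub>C\<close> alone dominates it. On the boundary the
  signs would turn into \<open>+\<close>, hence the restriction to the open region.\<close>

lemma inequality_vertical_angle:
  assumes nc: "\<not> collinear {A, B, C}" and M: "M \<in> bary_region A B C 1 (-1) (-1)"
  shows "bisector_term A B M C + bisector_term B C M A + bisector_term C A M B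
       \<le> dist M A + dist M B + dist M C"
proof -
  note D = orient_nonzero[OF nc]
  have cyc: "orient B C A = orient A B C" "orient C A B = orient A B C"
    by (simp_all add: orient_cyclic[of A B C] orient_cyclic[of C A B])
  have signs: "orient B C M / orient A B C > 0" "orient C A M / orient A B C < 0"
    "orient A B M / orient A B C < 0"
    using bary_region_signs[OF D(1) M] unfolding sgn_1_pos sgn_1_neg by auto
  have ABC: "M \<noteq> A" "M \<noteq> B" "M \<noteq> C" using signs by (auto simp: orient_def)
  have "bisector_term A B M C = half_angle_product (B - M) (C - M)"
    "bisector_term B C M A = - half_angle_product (C - M) (A - M)"
    "bisector_term C A M B = - half_angle_product (A - M) (B - M)"
    using signs ABC by (simp_all add: bisector_term_eq D cyc)
  moreover have "dist M B = norm (B - M)" "dist M C = norm (C - M)" "0 \<le> dist M A"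
    by (simp_all add: dist_norm norm_minus_commute)
  ultimately show ?thesis
    using half_angle_product_le[of "B - M" "C - M"] half_angle_product_nonneg[of "C - M" "A - M"]
      half_angle_product_nonneg[of "A - M" "B - M"] by linarith
qed

lemma inequality_at_vertex:
  fixes P Q M :: "'a::euclidean_space"
  assumes "P \<noteq> Q" "M \<noteq> P" "M \<noteq> Q"
  shows "(sqrt (dist M Q) / sqrt (dist M P) + sqrt (dist M P) / sqrt (dist M Q)) * bisector_length P M Q
       \<le> dist M P + dist M Q"
  unfolding weighted_bisector_length[OF assms]
  using half_angle_product_le[of "P - M" "Q - M"] by (simp add: dist_norm norm_minus_commute[of M])

theorem mainTheorem1:
  fixes A B C :: "real^2"
  assumes "\<not> collinear {A, B, C}"
  shows
    "(\<forall>M \<in> (closure (bary_region A B C (-1) 1 1) - {B, C}) \<union>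
           (closure (bary_region A B C 1 (-1) 1) - {A, C}) \<union>
           (closure (bary_region A B C 1 1 (-1)) - {A, B}) \<union>
           bary_region A B C 1 (-1) (-1) \<union>
           bary_region A B C (-1) 1 (-1) \<union>
           bary_region A B C (-1) (-1) 1.
        dist M A + dist M B + dist M C \<ge>
          (sqrt (dist M C) / sqrt (dist M B) + sqrt (dist M B) / sqrt (dist M C)) * signed_bisector A B M C +
          (sqrt (dist M C) / sqrt (dist M A) + sqrt (dist M A) / sqrt (dist M C)) * signed_bisector B C M A +
          (sqrt (dist M A) / sqrt (dist M B) + sqrt (dist M B) / sqrt (dist M A)) * signed_bisector C A M B) \<and>
     (\<forall>M. M = A \<longrightarrow>
        dist M B + dist M C \<ge>
          (sqrt (dist M C) / sqrt (dist M B) + sqrt (dist M B) / sqrt (dist M C)) * bisector_length B M C) \<and>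
     (\<forall>M. M = B \<longrightarrow>
        dist M A + dist M C \<ge>
          (sqrt (dist M C) / sqrt (dist M A) + sqrt (dist M A) / sqrt (dist M C)) * bisector_length C M A) \<and>
     (\<forall>M. M = C \<longrightarrow>
        dist M A + dist M B \<ge>
          (sqrt (dist M B) / sqrt (dist M A) + sqrt (dist M A) / sqrt (dist M B)) * bisector_length A M B)"
proof (intro conjI ballI allI impI)
  have nc: "\<not> collinear {A, B, C}" "\<not> collinear {B, C, A}" "\<not> collinear {C, A, B}"
    using assms by (simp_all add: insert_commute)
  then have ne: "A \<noteq> B" "B \<noteq> C" "C \<noteq> A" by (auto simp: insert_commute)
  {
    fix M assume "M \<in> (closure (bary_region A B C (-1) 1 1) - {B, C}) \<union>
           (closure (bary_region A B C 1 (-1) 1) - {A, C}) \<union>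
           (closure (bary_region A B C 1 1 (-1)) - {A, B}) \<union>
           bary_region A B C 1 (-1) (-1) \<union>
           bary_region A B C (-1) 1 (-1) \<union>
           bary_region A B C (-1) (-1) 1"
    \<comment> \<open>The other four regions arise from the two at \<open>A\<close> by cyclic renaming of the vertices.\<close>
    moreover have "bary_region A B C 1 (-1) 1 = bary_region B C A (-1) 1 1"
      "bary_region A B C (-1) 1 (-1) = bary_region B C A 1 (-1) (-1)"
      "bary_region A B C 1 1 (-1) = bary_region C A B (-1) 1 1"
      "bary_region A B C (-1) (-1) 1 = bary_region C A B 1 (-1) (-1)"
      by (rule bary_region_cyclic bary_region_cyclic[symmetric])+
    ultimately have "bisector_term A B M C + bisector_term B C M A + bisector_term C A M B
       \<le> dist M A + dist M B + dist M C"
      using nc[THEN inequality_beyond_side, of M] nc[THEN inequality_vertical_angle, of M]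
      by (auto simp: algebra_simps)
    then show "dist M A + dist M B + dist M C \<ge>
          (sqrt (dist M C) / sqrt (dist M B) + sqrt (dist M B) / sqrt (dist M C)) * signed_bisector A B M C +
          (sqrt (dist M C) / sqrt (dist M A) + sqrt (dist M A) / sqrt (dist M C)) * signed_bisector B C M A +
          (sqrt (dist M A) / sqrt (dist M B) + sqrt (dist M B) / sqrt (dist M A)) * signed_bisector C A M B"
      unfolding bisector_term_def by (simp only: add.commute)
  }
  {
    fix M assume "M = A"
    then show "dist M B + dist M C \<ge>
          (sqrt (dist M C) / sqrt (dist M B) + sqrt (dist M B) / sqrt (dist M C)) * bisector_length B M C"
      using inequality_at_vertex[of B C M] ne by simp
  }
  {
    fix M assume "M = B"
    then show "dist M A + dist M C \<ge>
          (sqrt (dist M C) / sqrt (dist M A) + sqrt (dist M A) / sqrt (dist M C)) * bisector_length C M A"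
      using inequality_at_vertex[of C A M] ne by (simp add: add.commute)
  }
  {
    fix M assume "M = C"
    then show "dist M A + dist M B \<ge>
          (sqrt (dist M B) / sqrt (dist M A) + sqrt (dist M A) / sqrt (dist M B)) * bisector_length A M B"
      using inequality_at_vertex[of A B M] ne by simp
  }
qed

end
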